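(* Let $\mathcal{X}=\overline{([x_1,x_2],0)}$ and $\mathcal{Y}=\overline{([y_1,y_2],0)}$ be in $\overline{\mathbb{IR}}^{+}$ with $\dfrac{x_1}{x_2}<\dfrac{y_1}{y_2}$. There is a unique pair $(\mathcal{Z},\mathcal{R})$ in $\overline{\mathbb{IR}}^{+}$ (that is, with $\mathcal{Z},\mathcal{R}\in\overline{\mathbb{IR}}^{+}$) such that $$\mathcal{Y}=\mathcal{X}\bullet\mathcal{Z}+\mathcal{R},\qquad l(\mathcal{R})=0\ \text{ and }\ c(\mathcal{R})\ \text{minimal}$$ (that is, $c(\mathcal{R})$ is minimal among all pairs $(\mathcal{Z},\mathcal{R})$ in $\overline{\mathbb{IR}}^{+}\times\overline{\mathbb{IR}}^{+}$ with $\mathcal{Y}=\mathcal{X}\bullet\mathcal{Z}+\mathcal{R}$ and $l(\mathcal{R})=0$). This pair is given by $$\mathcal{Z}=\frac{y_2-y_1}{x_2-x_1}\,\overline{([1,1],0)},\qquad \mathcal{R}=\frac{x_2y_1-x_1y_2}{x_2-x_1}\,\overline{([1,1],0)}.$$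
   Context: $\mathbb{IR}$ is the set of intervals $[a,b]$ with real $a\le b$, with addition $[a,b]+[c,d]=[a+c,b+d]$; $0$ also denotes $[0,0]$. $\overline{\mathbb{IR}}$ is the quotient of $\mathbb{IR}\times\mathbb{IR}$ by $(x,y)\sim(z,t)\iff x+t=y+z$, the class of $(x,y)$ being $\overline{(x,y)}$, with $\overline{(x,y)}+\overline{(z,t)}=\overline{(x+z,y+t)}$; every element can be written $\overline{(K,0)}$ or $\overline{(0,K)}$ with $K\in\mathbb{IR}$. For $\alpha\ge0$, $\alpha\overline{([a,b],0)}=\overline{([\alpha a,\alpha b],0)}$. $\overline{\mathbb{IR}}^{+}$ is the set of elements $\overline{([a,b],0)}$ with $0\le a\le b$; for such an element $l=b-a$ and $c=\frac{a+b}{2}$. $\mathcal{A}_4$ is the algebra $\mathbb{R}^4$ with product $x\cdot y=(x_1y_1+x_4y_4,\;x_2y_2+x_3y_3,\;x_3y_2+x_2y_3,\;x_4y_1+x_1y_4)$. For $K=[a,b]\in\mathbb{IR}$, $\varphi(K)=(a,b,0,0)$ if $a,b\ge0$; $(0,b,-a,0)$ if $a\le 0\le b$; $(0,0,-a,-b)$ if $a,b\le 0$. Define $\overline{\varphi}:\overline{\mathbb{IR}}\to\mathcal{A}_4$ by $\overline{\varphi}(\overline{(K,0)})=\varphi(K)$, $\overline{\varphi}(\overline{(0,K)})=-\varphi(K)$. Consider on $\mathcal{A}_4$ the equivalence relation $(x_1,x_2,x_3,x_4)\sim(y_1,y_2,y_3,y_4)\iff x_1-y_1=x_3-y_3$ and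 $x_2-y_2=x_4-y_4$; the composite of $\overline{\varphi}$ with the projection to the quotient is a bijection, whose inverse is denoted $\psi$. Explicitly, with $u=x_1-x_3$, $v=x_2-x_4$, $\psi$ sends the class of $(x_1,x_2,x_3,x_4)$ to $\overline{([u,v],0)}$ if $u\le v$ and to $\overline{(0,[-u,-v])}$ if $u\ge v$. The product on $\overline{\mathbb{IR}}$ is $\mathcal{X}\bullet\mathcal{X}'=\psi$ of the class of $\overline{\varphi}(\mathcal{X})\cdot\overline{\varphi}(\mathcal{X}')$.
   Formalization: Uniqueness of the pair is claimed only if x_1>0 or y_1=y_2 (otherwise false: X=[0,1], Y=[1,2], Z=[z,1] for any z in [0,1]); the formulas, minimality and uniqueness of R hold always. Classes of points [k,k] are read as (K,0) in defining φ̄, which is otherwise ambiguous. *)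

theory Defs
  imports "HOL-Library.Interval" "HOL-Library.Product_Plus"
begin

text \<open>
  The library type \<open>real interval\<close> consists of the nonempty compact intervals;
  \<open>Interval (a, b)\<close> is \<open>[a, b]\<close> for \<open>a \<le> b\<close>.
\<close>

lemma bounds_Interval [simp]:
  fixes a b :: real
  assumes "a \<le> b"
  shows "lower (Interval (a, b)) = a" and "upper (Interval (a, b)) = b"
  using assms by (simp_all add: lower.rep_eq upper.rep_eq Interval_inverse)

lemma Interval_bounds [simp]: "Interval (lower K, upper K) = (K :: real interval)"
  by (simp add: interval_eq_iff)


section \<open>The completed semigroup of intervals\<close>

definition ivl_rel :: "real interval \<times> real interval \<Rightarrow> real interval \<times> real interval \<Rightarrow> bool"
  where "ivl_rel = (\<lambda>(x, y) (z, t). x + t = y + z)"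

quotient_type gint = "real interval \<times> real interval" / ivl_rel
  by (rule equivpI)
     (auto simp: ivl_rel_def reflp_def symp_def transp_def interval_eq_iff)

lift_definition cls :: "real interval \<Rightarrow> real interval \<Rightarrow> gint" is Pair .

lemma cls_eq_iff: "cls x y = cls z t \<longleftrightarrow> x + t = y + z"
  by transfer (simp add: ivl_rel_def)

lemma cls_0_inject [simp]:
  "cls K 0 = cls L 0 \<longleftrightarrow> K = L" "cls 0 K = cls 0 L \<longleftrightarrow> K = L"
  by (auto simp: cls_eq_iff)

lemma gint_cases:
  obtains K where "X = cls K 0"
  | K where "X = cls 0 K" "lower K < upper K"
proof -
  have "\<exists>x y. X = cls x y"
    by (induction X rule: gint.abs_induct) (metis cls.abs_eq surj_pair)
  then obtain x y where X: "X = cls x y"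
    by blast
  show thesis
  proof (cases "lower x - lower y \<le> upper x - upper y")
    case True
    then have "X = cls (Interval (lower x - lower y, upper x - upper y)) 0"
      by (simp add: X cls_eq_iff interval_eq_iff)
    then show thesis by (rule that)
  next
    case False
    then have "X = cls 0 (Interval (lower y - lower x, upper y - upper x))"
      by (simp add: X cls_eq_iff interval_eq_iff)
    then show thesis by (rule that) (use False in simp)
  qed
qed

instantiation gint :: plus
begin

lift_definition plus_gint :: "gint \<Rightarrow> gint \<Rightarrow> gint"
  is "\<lambda>(x, y) (z, t). (x + z, y + t)"
  by (auto simp: ivl_rel_def interval_eq_iff)

instance ..

end

lemma plus_cls [simp]: "cls x y + cls z t = cls (x + z) (y + t)"
  by transfer (simp add: ivl_rel_def add.commute)

text \<open>
  Scalar multiplication. Only nonnegative scalars matter here; for negative ones the two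
  components are swapped, so that \<open>(- 1)\<close> times the class of \<open>(x, y)\<close> is its opposite,
  the class of \<open>(y, x)\<close>.
\<close>

instantiation gint :: scaleR
begin

lift_definition scaleR_gint :: "real \<Rightarrow> gint \<Rightarrow> gint"
  is "\<lambda>\<alpha> (x, y). if 0 \<le> \<alpha> then (interval_of \<alpha> * x, interval_of \<alpha> * y)
                 else (interval_of (- \<alpha>) * y, interval_of (- \<alpha>) * x)"
proof -
  fix \<alpha> :: real and p q :: "real interval \<times> real interval"
  have scale: "lower (interval_of \<beta> * K) = \<beta> * lower K" "upper (interval_of \<beta> * K) = \<beta> * upper K"
    if "0 \<le> \<beta>" for \<beta> and K :: "real interval"
    using mult_left_mono[OF lower_le_upper that, of K]
    by (simp_all add: lower_times upper_times)
  assume "ivl_rel p q"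
  then show "ivl_rel (case p of (x, y) \<Rightarrow> if 0 \<le> \<alpha> then (interval_of \<alpha> * x, interval_of \<alpha> * y)
                 else (interval_of (- \<alpha>) * y, interval_of (- \<alpha>) * x))
        (case q of (x, y) \<Rightarrow> if 0 \<le> \<alpha> then (interval_of \<alpha> * x, interval_of \<alpha> * y)
                 else (interval_of (- \<alpha>) * y, interval_of (- \<alpha>) * x))"
    by (auto simp: ivl_rel_def interval_eq_iff scale case_prod_beta simp del: mult_minus_left simp flip: distrib_left)
qed

instance ..

end

lemma scaleR_cls_Interval:
  assumes "0 \<le> \<alpha>" "a \<le> b"
  shows "\<alpha> *\<^sub>R cls (Interval (a, b)) 0 = cls (Interval (\<alpha> * a, \<alpha> * b)) 0"
proof -
  have "interval_of \<alpha> * Interval (a, b) = Interval (\<alpha> * a, \<alpha> * b)"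
    and "interval_of \<alpha> * 0 = (0 :: real interval)"
    using assms mult_left_mono[OF assms(2,1)]
    by (simp_all add: interval_eq_iff lower_times upper_times)
  with assms show ?thesis
    by (simp add: scaleR_gint.abs_eq cls.abs_eq)
qed

definition gint_nonneg :: "gint set"
  where "gint_nonneg = {cls (Interval (a, b)) 0 | a b. 0 \<le> a \<and> a \<le> b}"

text \<open>
  The interval \<open>K\<close> for classes of the form \<open>cls K 0\<close>; it is unique by \<open>cls_0_inject\<close>.
  Length and centre are only meaningful for such classes.
\<close>

definition the_ivl :: "gint \<Rightarrow> real interval"
  where "the_ivl X = (THE K. X = cls K 0)"

definition len :: "gint \<Rightarrow> real"
  where "len X = width (the_ivl X)"

definition centre :: "gint \<Rightarrow> real"
  where "centre X = (lower (the_ivl X) + upper (the_ivl X)) / 2"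

lemma the_ivl_cls [simp]: "the_ivl (cls K 0) = K"
  by (simp add: the_ivl_def)


section \<open>The product via the four-dimensional algebra\<close>

type_synonym a4 = "real \<times> real \<times> real \<times> real"

fun a4_mult :: "a4 \<Rightarrow> a4 \<Rightarrow> a4" (infixl \<open>\<cdot>\<^sub>4\<close> 70)
  where "(x1, x2, x3, x4) \<cdot>\<^sub>4 (y1, y2, y3, y4) =
    (x1 * y1 + x4 * y4, x2 * y2 + x3 * y3, x3 * y2 + x2 * y3, x4 * y1 + x1 * y4)"

text \<open>The three cases agree where they overlap, so their order is immaterial.\<close>

definition phi :: "real interval \<Rightarrow> a4"
  where "phi K = (let a = lower K; b = upper K in
    if 0 \<le> a then (a, b, 0, 0)
    else if 0 \<le> b then (0, b, - a, 0)
    else (0, 0, - a, - b))"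

text \<open>
  A class that has both a representative \<open>(K, 0)\<close> and a representative \<open>(0, L)\<close>
  (this happens exactly for \<open>K = [k, k]\<close>, \<open>L = [- k, - k]\<close>) is read as \<open>(K, 0)\<close>;
  for \<open>k \<noteq> 0\<close> the vectors \<open>phi K\<close> and \<open>- phi L\<close> differ, although they are equivalent
  under the relation \<open>a4_rel\<close> below.
\<close>

definition phibar :: "gint \<Rightarrow> a4"
  where "phibar X = (if \<exists>K. X = cls K 0 then phi (THE K. X = cls K 0)
                     else - phi (THE K. X = cls 0 K))"

lemma phibar_cls: "phibar (cls K 0) = phi K"
  by (simp add: phibar_def)

lemma phibar_cls_neg: "lower K < upper K \<Longrightarrow> phibar (cls 0 K) = - phi K"
proof -
  assume *: "lower K < upper K"
  have "cls 0 K \<noteq> cls L 0" for L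
  proof
    assume "cls 0 K = cls L 0"
    then have "lower K + lower L = 0" "upper K + upper L = 0"
      by (simp_all add: cls_eq_iff interval_eq_iff)
    moreover have "lower L \<le> upper L"
      by simp
    ultimately show False
      using * by linarith
  qed
  then show ?thesis
    by (simp add: phibar_def)
qed

definition a4_rel :: "a4 \<Rightarrow> a4 \<Rightarrow> bool"
  where "a4_rel = (\<lambda>(x1, x2, x3, x4) (y1, y2, y3, y4).
    x1 - y1 = x3 - y3 \<and> x2 - y2 = x4 - y4)"

quotient_type a4q = a4 / a4_rel
  by (rule equivpI) (auto simp: a4_rel_def reflp_def symp_def transp_def)

lift_definition a4_proj :: "a4 \<Rightarrow> a4q" is "\<lambda>x. x" .

lemma a4_proj_eq_iff:
  "a4_proj (x1, x2, x3, x4) = a4_proj (y1, y2, y3, y4) \<longleftrightarrow>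
    x1 - x3 = y1 - y3 \<and> x2 - x4 = y2 - y4"
  by transfer (auto simp: a4_rel_def)

lemma a4_proj_phi: "a4_proj (phi K) = a4_proj (lower K, upper K, 0, 0)"
  and a4_proj_uminus_phi: "a4_proj (- phi K) = a4_proj (- lower K, - upper K, 0, 0)"
  by (auto simp: phi_def Let_def a4_proj_eq_iff)

lemma bij_proj_phibar: "bij (a4_proj \<circ> phibar)"
proof (rule bijI)
  show "inj (a4_proj \<circ> phibar)"
  proof (rule injI)
    fix X Y
    assume eq: "(a4_proj \<circ> phibar) X = (a4_proj \<circ> phibar) Y"
    show "X = Y"
      by (rule gint_cases[of X]; rule gint_cases[of Y])
         (use eq in \<open>auto simp: phibar_cls phibar_cls_neg a4_proj_phi a4_proj_uminus_phi
            a4_proj_eq_iff cls_eq_iff interval_eq_iff\<close>)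
  qed
next
  have "\<exists>X. a4_proj x = a4_proj (phibar X)" for x
  proof -
    obtain x1 x2 x3 x4 where x: "x = (x1, x2, x3, x4)" by (cases x) auto
    show ?thesis
    proof (cases "x1 - x3 \<le> x2 - x4")
      case True
      then have "a4_proj x = a4_proj (phibar (cls (Interval (x1 - x3, x2 - x4)) 0))"
        by (simp add: x phibar_cls a4_proj_phi a4_proj_eq_iff)
      then show ?thesis ..
    next
      case False
      then have "a4_proj x = a4_proj (phibar (cls 0 (Interval (x3 - x1, x4 - x2))))"
        by (simp add: x phibar_cls_neg a4_proj_uminus_phi a4_proj_eq_iff)
      then show ?thesis ..
    qed
  qed
  moreover have "\<exists>x. q = a4_proj x" for q
    by (induction q rule: a4q.abs_induct) (metis a4_proj.abs_eq)
  ultimately show "surj (a4_proj \<circ> phibar)"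
    by (metis comp_apply surjI surj_def)
qed

definition psi :: "a4q \<Rightarrow> gint"
  where "psi = inv (a4_proj \<circ> phibar)"

lemma psi_le:
  "x1 - x3 \<le> x2 - x4 \<Longrightarrow> psi (a4_proj (x1, x2, x3, x4)) = cls (Interval (x1 - x3, x2 - x4)) 0"
  unfolding psi_def
  by (rule inv_f_eq[OF bij_is_inj[OF bij_proj_phibar]])
     (simp add: phibar_cls a4_proj_phi a4_proj_eq_iff)

lemma psi_ge:
  assumes "x2 - x4 \<le> x1 - x3"
  shows "psi (a4_proj (x1, x2, x3, x4)) = cls 0 (Interval (- (x1 - x3), - (x2 - x4)))"
proof (cases "x2 - x4 = x1 - x3")
  case True
  then show ?thesis
    by (simp add: psi_le cls_eq_iff interval_eq_iff)
next
  case False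
  with assms show ?thesis
    unfolding psi_def
    by (intro inv_f_eq[OF bij_is_inj[OF bij_proj_phibar]])
       (simp add: phibar_cls_neg a4_proj_uminus_phi a4_proj_eq_iff)
qed

definition gmult :: "gint \<Rightarrow> gint \<Rightarrow> gint" (infixl \<open>\<bullet>\<^sub>g\<close> 70)
  where "X \<bullet>\<^sub>g Y = psi (a4_proj (phibar X \<cdot>\<^sub>4 phibar Y))"


section \<open>Division with minimal exact remainder\<close>

definition division :: "gint \<Rightarrow> gint \<Rightarrow> gint \<times> gint \<Rightarrow> bool"
  where "division X Y = (\<lambda>(Z, R). Z \<in> gint_nonneg \<and> R \<in> gint_nonneg \<and>
    Y = X \<bullet>\<^sub>g Z + R \<and> len R = 0)"

definition minimal_division :: "gint \<Rightarrow> gint \<Rightarrow> gint \<times> gint \<Rightarrow> bool"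
  where "minimal_division X Y = is_arg_min (\<lambda>(Z, R). centre R) (division X Y)"

end

theory Submission
  imports Defs
begin

text \<open>
  On nonnegative intervals the product acts bound by bound, so a division of \<open>[y1, y2]\<close> by
  \<open>[x1, x2]\<close> with quotient \<open>[z1, z2]\<close> and remainder \<open>[r, r]\<close> means \<open>y1 = x1 z1 + r\<close> and
  \<open>y2 = x2 z2 + r\<close>. Subtracting and using \<open>z1 \<le> z2\<close> gives \<open>y2 - y1 \<ge> (x2 - x1) z2\<close>, and
  this upper bound on \<open>z2\<close> is a lower bound on \<open>r = y2 - x2 z2\<close>, attained for \<open>z1 = z2\<close>.
  Equality forces \<open>x1 z1 = x1 z2\<close>, hence determines \<open>z1\<close> unless \<open>x1 = 0\<close>; for \<open>x1 = 0\<close> the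
  lower bound \<open>z1\<close> is an arbitrary element of \<open>[0, z2]\<close>, and the quotient is unique only if
  \<open>z2 = 0\<close>, that is, \<open>y1 = y2\<close>.
\<close>

lemma gint_nonnegE:
  assumes "X \<in> gint_nonneg"
  obtains a b where "X = cls (Interval (a, b)) 0" "0 \<le> a" "a \<le> b"
  using assms by (auto simp: gint_nonneg_def)

lemma cls_Interval_in_gint_nonneg:
  "0 \<le> a \<Longrightarrow> a \<le> b \<Longrightarrow> cls (Interval (a, b)) 0 \<in> gint_nonneg"
  by (auto simp: gint_nonneg_def)

text \<open>Nonnegative intervals fall into the first case of \<open>phi\<close>, so the last two
  coordinates vanish and the product in the algebra is \<open>(a * c, b * d, 0, 0)\<close>. As
  \<open>a * c \<le> b * d\<close>, \<open>psi_le\<close> reads off the class.\<close>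

lemma gmult_nonneg:
  assumes "0 \<le> a" "a \<le> b" "0 \<le> c" "c \<le> d"
  shows "cls (Interval (a, b)) 0 \<bullet>\<^sub>g cls (Interval (c, d)) 0 = cls (Interval (a * c, b * d)) 0"
  using assms mult_mono[of a b c d] by (simp add: gmult_def phibar_cls phi_def psi_le)

lemma len_cls_Interval: "a \<le> b \<Longrightarrow> len (cls (Interval (a, b)) 0) = b - a"
  by (simp add: len_def width_def)

lemma centre_cls_Interval: "a \<le> b \<Longrightarrow> centre (cls (Interval (a, b)) 0) = (a + b) / 2"
  by (simp add: centre_def)

lemma division_cls_iff:
  assumes "0 \<le> x1" "x1 \<le> x2" "y1 \<le> y2" "0 \<le> z1" "z1 \<le> z2" "0 \<le> r1" "r1 \<le> r2"
  shows "division (cls (Interval (x1, x2)) 0) (cls (Interval (y1, y2)) 0)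
      (cls (Interval (z1, z2)) 0, cls (Interval (r1, r2)) 0) \<longleftrightarrow>
    r1 = r2 \<and> y1 = x1 * z1 + r1 \<and> y2 = x2 * z2 + r1"
  using assms mult_mono[of x1 x2 z1 z2]
  by (auto simp: division_def cls_Interval_in_gint_nonneg gmult_nonneg len_cls_Interval
      interval_eq_iff)

lemma divisionE:
  assumes "division (cls (Interval (x1, x2)) 0) (cls (Interval (y1, y2)) 0) (Z, R)"
    and "0 \<le> x1" "x1 \<le> x2" "y1 \<le> y2"
  obtains z1 z2 r where "Z = cls (Interval (z1, z2)) 0" "R = cls (Interval (r, r)) 0"
    "0 \<le> z1" "z1 \<le> z2" "0 \<le> r" "y1 = x1 * z1 + r" "y2 = x2 * z2 + r"
proof -
  from assms(1) have "Z \<in> gint_nonneg" "R \<in> gint_nonneg"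
    by (simp_all add: division_def)
  then obtain z1 z2 r1 r2 where ZR: "Z = cls (Interval (z1, z2)) 0" "0 \<le> z1" "z1 \<le> z2"
    "R = cls (Interval (r1, r2)) 0" "0 \<le> r1" "r1 \<le> r2"
    by (elim gint_nonnegE)
  with assms division_cls_iff[of x1 x2 y1 y2 z1 z2 r1 r2] show thesis
    using that[of z1 z2 r1] by simp
qed

lemma remainder_bounds:
  fixes x1 x2 y1 y2 z1 z2 r :: real
  assumes "0 \<le> x1" "x1 < x2" "z1 \<le> z2" "y1 = x1 * z1 + r" "y2 = x2 * z2 + r"
  defines "z \<equiv> (y2 - y1) / (x2 - x1)" and "s \<equiv> (x2 * y1 - x1 * y2) / (x2 - x1)"
  shows "s \<le> r" and "r = s \<Longrightarrow> z2 = z \<and> x1 * z1 = x1 * z2"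
proof -
  \<comment> \<open>Eliminating \<open>y1\<close> and \<open>y2\<close> expresses the excess of
    \<open>r\<close> over \<open>s\<close> through the nonnegative gap
    \<open>x1 * z2 - x1 * z1\<close>; this identity yields both the bound and the equality
    case.\<close>
  have diff: "(x2 - x1) * (r - s) = x2 * (x1 * z2 - x1 * z1)"
  proof -
    have "(x2 - x1) * s = x2 * y1 - x1 * y2"
      using assms(2) by (simp add: s_def)
    then have "(x2 - x1) * (r - s) = (x2 - x1) * r - (x2 * y1 - x1 * y2)"
      unfolding right_diff_distrib[of "x2 - x1"] by simp
    also have "\<dots> = x2 * (x1 * z2 - x1 * z1)"
      unfolding assms(4,5) by (simp add: algebra_simps)
    finally show ?thesis .
  qed
  have "0 \<le> (x2 - x1) * (r - s)"
    unfolding diff using assms by (simp add: mult_left_mono)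
  with \<open>x1 < x2\<close> show "s \<le> r"
    by (simp add: zero_le_mult_iff)
  assume "r = s"
  \<comment> \<open>Since \<open>x2 > 0\<close>, the gap itself vanishes.\<close>
  with diff assms(1,2) have eq: "x1 * z1 = x1 * z2"
    by auto
  then have "y2 - y1 = (x2 - x1) * z2"
    unfolding assms(4,5) left_diff_distrib by linarith
  with eq \<open>x1 < x2\<close> show "z2 = z \<and> x1 * z1 = x1 * z2"
    by (simp add: z_def)
qed

theorem theorem24:
  fixes x1 x2 y1 y2 :: real and X Y Z0 R0 :: gint
  assumes "0 \<le> x1" "x1 \<le> x2" "x2 \<noteq> 0"
    and "0 \<le> y1" "y1 \<le> y2" "y2 \<noteq> 0"
    and "X = cls (Interval (x1, x2)) 0"
    and "Y = cls (Interval (y1, y2)) 0"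
    and "x1 / x2 < y1 / y2"
    and "Z0 = ((y2 - y1) / (x2 - x1)) *\<^sub>R cls (Interval (1, 1)) 0"
    and "R0 = ((x2 * y1 - x1 * y2) / (x2 - x1)) *\<^sub>R cls (Interval (1, 1)) 0"
  shows "minimal_division X Y (Z0, R0) \<and>
    (\<forall>Z R. minimal_division X Y (Z, R) \<longrightarrow> R = R0) \<and>
    (0 < x1 \<or> y1 = y2 \<longrightarrow> (\<exists>!(Z, R). minimal_division X Y (Z, R)))"
proof -
  define z s where "z = (y2 - y1) / (x2 - x1)" and "s = (x2 * y1 - x1 * y2) / (x2 - x1)"
  \<comment> \<open>Both denominators are positive. The inequality serves twice: it excludes
    \<open>x1 = x2\<close> and makes \<open>s\<close> nonnegative.\<close>
  have cross: "x1 * y2 < y1 * x2"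
    using assms(1-6,9) by (simp add: divide_simps split: if_splits)
  have lt: "x1 < x2"
  proof (rule ccontr)
    assume "\<not> x1 < x2"
    \<comment> \<open>Here \<open>x1 = x2\<close>, so \<open>cross\<close> would contradict
      \<open>y1 \<le> y2\<close>.\<close>
    with assms(2) cross have "x2 * y2 < x2 * y1"
      by (simp add: mult.commute)
    with assms(1,2,5) show False
      by (smt (verit) mult_left_mono)
  qed
  have z: "0 \<le> z" and s: "0 \<le> s"
    using lt cross assms(5) by (simp_all add: z_def s_def mult.commute)
  have Z0: "Z0 = cls (Interval (z, z)) 0" and R0: "R0 = cls (Interval (s, s)) 0"
    using z s by (simp_all add: assms(10,11) scaleR_cls_Interval flip: z_def s_def)
  have eqs: "y1 = x1 * z + s" "y2 = x2 * z + s"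
  proof -
    have zs: "z * (x2 - x1) = y2 - y1" "s * (x2 - x1) = x2 * y1 - x1 * y2"
      using lt by (simp_all add: z_def s_def)
    \<comment> \<open>Multiplying by the nonzero \<open>x2 - x1\<close> clears the denominators of
      \<open>z\<close> and \<open>s\<close>.\<close>
    have "(x1 * z + s) * (x2 - x1) = y1 * (x2 - x1)" "(x2 * z + s) * (x2 - x1) = y2 * (x2 - x1)"
      unfolding distrib_right mult.assoc zs by (simp_all add: algebra_simps)
    with lt show "y1 = x1 * z + s" "y2 = x2 * z + s"
      by simp_all
  qed
  have div0: "division X Y (Z0, R0)"
    using assms(1,2,5) z s eqs by (simp add: assms(7,8) Z0 R0 division_cls_iff)
  have least: "centre R0 \<le> centre R"
    and attained: "centre R = centre R0 \<Longrightarrow>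
      R = R0 \<and> (\<exists>z1. Z = cls (Interval (z1, z)) 0 \<and> 0 \<le> z1 \<and> z1 \<le> z \<and> x1 * z1 = x1 * z)"
    if ZR: "division X Y (Z, R)" for Z R
  proof -
    from ZR[unfolded assms(7,8)] assms(1,2,5)
    obtain z1 z2 r where *: "Z = cls (Interval (z1, z2)) 0" "R = cls (Interval (r, r)) 0"
      "0 \<le> z1" "z1 \<le> z2" "0 \<le> r" "y1 = x1 * z1 + r" "y2 = x2 * z2 + r"
      by (rule divisionE)
    note bounds = remainder_bounds[OF assms(1) lt *(4,6,7), folded z_def s_def]
    show "centre R0 \<le> centre R"
      using bounds(1) by (simp add: *(2) R0 centre_cls_Interval)
    assume "centre R = centre R0"
    then have "r = s"
      by (simp add: *(2) R0 centre_cls_Interval)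
    with bounds(2) * show
      "R = R0 \<and> (\<exists>z1. Z = cls (Interval (z1, z)) 0 \<and> 0 \<le> z1 \<and> z1 \<le> z \<and> x1 * z1 = x1 * z)"
      by (auto simp: R0)
  qed
  have min0: "minimal_division X Y (Z0, R0)"
    using div0 least by (auto simp: minimal_division_def is_arg_min_linorder)
  \<comment> \<open>Minimality against the competitor \<open>(Z0, R0)\<close> gives one inequality
    between the centres, \<open>least\<close> the other.\<close>
  have min: "division X Y (Z, R) \<and> centre R = centre R0"
    if "minimal_division X Y (Z, R)" for Z R
    using that div0 least[of Z R]
    by (fastforce simp: minimal_division_def is_arg_min_linorder)
  have unique: "Z = Z0" if "minimal_division X Y (Z, R)" and "0 < x1 \<or> y1 = y2" for Z R
  proof -
    from min[OF that(1)] attained obtain z1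
      where z1: "Z = cls (Interval (z1, z)) 0" "0 \<le> z1" "z1 \<le> z" "x1 * z1 = x1 * z"
      by blast
    \<comment> \<open>A positive \<open>x1\<close> cancels; if \<open>y1 = y2\<close>, then
      \<open>z = 0\<close> and \<open>z1\<close> is squeezed to 0.\<close>
    from that(2) have "z1 = z"
    proof
      assume "y1 = y2"
      then have "z = 0"
        by (simp add: z_def)
      with z1 show ?thesis
        by simp
    qed (use z1 in simp)
    with z1 show ?thesis
      by (simp add: Z0)
  qed
  have remainder: "R = R0" if "minimal_division X Y (Z, R)" for Z R
    using min[OF that] attained by blast
  have "\<exists>!(Z, R). minimal_division X Y (Z, R)" if "0 < x1 \<or> y1 = y2"
  proof (rule ex1I[of _ "(Z0, R0)"])
    fix p
    assume "case p of (Z, R) \<Rightarrow> minimal_division X Y (Z, R)"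
    then have "minimal_division X Y (fst p, snd p)"
      by (simp add: case_prod_beta)
    with that show "p = (Z0, R0)"
      using unique remainder by (metis prod.collapse)
  qed (simp add: min0)
  with min0 remainder show ?thesis
    by blast
qed

end
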